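(* Let $K\ge2$, let $1=s_1\le s_2\le\cdots\le s_K$ be real numbers and let $c_1,\dots,c_K$ be nonzero real numbers with $\sum_{k=1}^K c_k^2=1$. Let $$f(\lambda)=\lambda+\sum_{k=1}^K\frac{c_k^2}{\lambda-s_k}.$$ Put $d_1=s_2-s_1$, $d_2=s_K-s_1$, and for $i=1,2$ let $$p_i(t)=t^4+2d_i\,t^3+(d_i^2-1)\,t^2-2c_1^2d_i\,t-c_1^2d_i^2 .$$ Then each $p_i$ has a unique root $t_i$ in the interval $[\,|c_1|,1\,]$, and $f$ has a unique global minimiser, and it lies in the interval $(1-t_1,\,1-t_2)$, where in the degenerate case $s_2=s_K$ (so that $t_1=t_2$) this interval is understood as the single point $1-t_1=1-t_2$.
   Context: $f$ is considered on $\mathbb{R}\setminus\{s_1,\dots,s_K\}$. "Global minimiser of $f$" means the point minimising $f$ among all real roots of $f'(\lambda)=1-\sum_{k=1}^K c_k^2/(\lambda-s_k)^2$ (these roots are the candidate Lagrange multipliers of the problem of minimising $\tfrac12\sum_k s_kx_k^2+\sum_k c_kx_k$ over the unit sphere). *)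

theory Defs
  imports Complex_Main
begin

definition secular :: "nat \<Rightarrow> (nat \<Rightarrow> real) \<Rightarrow> (nat \<Rightarrow> real) \<Rightarrow> real \<Rightarrow> real" where
  "secular K s c l = l + (\<Sum>k = 1..K. (c k)\<^sup>2 / (l - s k))"

text \<open>The poles are excluded explicitly, because division by zero makes
  \<^const>\<open>secular\<close> total.\<close>

definition crit_points :: "nat \<Rightarrow> (nat \<Rightarrow> real) \<Rightarrow> (nat \<Rightarrow> real) \<Rightarrow> real set" where
  "crit_points K s c =
     {l. l \<notin> s ` {1..K} \<and> (secular K s c has_real_derivative 0) (at l)}"

lemma secular_has_real_derivative:
  assumes "l \<notin> s ` {1..K}"
  shows "(secular K s c has_real_derivative (1 - (\<Sum>k = 1..K. (c k)\<^sup>2 / (l - s k)\<^sup>2))) (at l)"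
proof -
  have "((\<lambda>l. l + (\<Sum>k = 1..K. (c k)\<^sup>2 / (l - s k))) has_real_derivative
          (1 + (\<Sum>k = 1..K. - ((c k)\<^sup>2 / (l - s k)\<^sup>2)))) (at l)"
    using assms
    by (auto intro!: derivative_eq_intros sum.cong simp: power2_eq_square)
  then show ?thesis
    by (simp add: secular_def[abs_def] sum_negf)
qed

lemma mem_crit_points_iff:
  "l \<in> crit_points K s c \<longleftrightarrow>
     l \<notin> s ` {1..K} \<and> 1 - (\<Sum>k = 1..K. (c k)\<^sup>2 / (l - s k)\<^sup>2) = 0"
  unfolding crit_points_def
  by (metis (mono_tags, lifting) DERIV_unique mem_Collect_eq secular_has_real_derivative)

text \<open>Minimality is among the critical points only: the function itself is unbounded
  below near each pole (from the left) and at minus infinity.\<close>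

definition global_minimiser :: "nat \<Rightarrow> (nat \<Rightarrow> real) \<Rightarrow> (nat \<Rightarrow> real) \<Rightarrow> real \<Rightarrow> bool" where
  "global_minimiser K s c l \<longleftrightarrow>
     is_arg_min (secular K s c) (\<lambda>m. m \<in> crit_points K s c) l"

definition quartic :: "real \<Rightarrow> real \<Rightarrow> real \<Rightarrow> real" where
  "quartic a d t =
     t ^ 4 + 2 * d * t ^ 3 + (d\<^sup>2 - 1) * t\<^sup>2 - 2 * a\<^sup>2 * d * t - a\<^sup>2 * d\<^sup>2"

definition quartic_root :: "real \<Rightarrow> real \<Rightarrow> real \<Rightarrow> bool" where
  "quartic_root a d t \<longleftrightarrow> t \<in> {\<bar>a\<bar>..1} \<and> quartic a d t = 0"

end

theory Submission
  imports Defs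
begin

text \<open>
  Write \<open>\<phi>(l) = \<Sum>\<^sub>k c\<^sub>k\<^sup>2 / (l - s\<^sub>k)\<^sup>2\<close>, so that the critical points are the solutions of
  \<open>\<phi> = 1\<close> off the poles.  Two observations carry the theorem.

  First, the smallest critical point is the strict global minimiser.  At critical points
  \<open>l\<close> and \<open>m\<close> the vectors with entries \<open>c\<^sub>k / (l - s\<^sub>k)\<close> and \<open>c\<^sub>k / (m - s\<^sub>k)\<close> are unit vectors, and
  \<open>f(m) - f(l)\<close> equals \<open>m - l\<close> times one minus their inner product, that is, half their
  squared distance.  Hence \<open>f\<close> is strictly increasing along the critical points
  (\<open>secular_strict_mono_crit\<close>).  To the left of the first pole \<open>s\<^sub>1 = 1\<close> the function \<open>\<phi>\<close> is
  strictly increasing (\<open>inv_sq_sum_strict_mono\<close>), so at most one critical point lies there, and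
  if there is one then it is the smallest of all.

  Secondly, moving every pole except \<open>s\<^sub>1\<close> to the common position \<open>s\<^sub>1 + d\<close> turns \<open>\<phi>(1 - t)\<close> into
  \<open>h\<^sub>d(t) = c\<^sub>1\<^sup>2 / t\<^sup>2 + (1 - c\<^sub>1\<^sup>2) / (t + d)\<^sup>2\<close>, and clearing denominators in \<open>h\<^sub>d(t) = 1\<close> gives the
  quartic (\<open>quartic_eq_two_pole\<close>).  As \<open>h\<^sub>d\<close> is strictly decreasing for \<open>t > 0\<close>, is at least \<open>1\<close> at
  \<open>\<bar>c\<^sub>1\<bar>\<close> and at most \<open>1\<close> at \<open>1\<close>, the quartic has exactly one root in between.
  To the left of all poles, moving a pole to the right decreases \<open>\<phi>\<close>, so
  \<open>h\<^bsub>d2\<^esub>(t) \<le> \<phi>(1 - t) \<le> h\<^bsub>d1\<^esub>(t)\<close>, for \<open>t > 0\<close>, strictly if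
  \<open>s\<^sub>2 < s\<^sub>K\<close>.  Therefore \<open>\<phi>\<close> crosses the value \<open>1\<close> between \<open>1 - t\<^sub>1\<close> and \<open>1 - t\<^sub>2\<close>.
\<close>

section \<open>The quartic as a secular equation with two poles\<close>

definition two_pole :: "real \<Rightarrow> real \<Rightarrow> real \<Rightarrow> real" where
  "two_pole a d t = a\<^sup>2 / t\<^sup>2 + (1 - a\<^sup>2) / (t + d)\<^sup>2"

lemma quartic_eq_two_pole:
  assumes "t > 0" "d \<ge> 0"
  shows "quartic a d t = t\<^sup>2 * (t + d)\<^sup>2 * (1 - two_pole a d t)"
proof -
  have "t \<noteq> 0" "t + d \<noteq> 0" using assms by auto
  then have "t\<^sup>2 * (a\<^sup>2 / t\<^sup>2) = a\<^sup>2" "(t + d)\<^sup>2 * ((1 - a\<^sup>2) / (t + d)\<^sup>2) = 1 - a\<^sup>2"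
    by simp_all
  then have "t\<^sup>2 * (t + d)\<^sup>2 * (1 - two_pole a d t)
      = t\<^sup>2 * (t + d)\<^sup>2 - a\<^sup>2 * (t + d)\<^sup>2 - (1 - a\<^sup>2) * t\<^sup>2"
    unfolding two_pole_def by algebra
  also have "\<dots> = quartic a d t"
    unfolding quartic_def by algebra
  finally show ?thesis by simp
qed

lemma quartic_root_iff_two_pole:
  assumes "a \<noteq> 0" "d \<ge> 0"
  shows "quartic_root a d t \<longleftrightarrow> t \<in> {\<bar>a\<bar>..1} \<and> two_pole a d t = 1"
proof (cases "t \<in> {\<bar>a\<bar>..1}")
  case True
  then have "t > 0" using assms by auto
  with assms True show ?thesis
    by (auto simp: quartic_root_def quartic_eq_two_pole)
qed (auto simp: quartic_root_def)

lemma two_pole_strict_antimono: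
  assumes "a \<noteq> 0" "\<bar>a\<bar> \<le> 1" "d \<ge> 0" "0 < x" "x < y"
  shows "two_pole a d y < two_pole a d x"
proof -
  have "a\<^sup>2 \<le> 1" using assms(2) by (simp add: abs_square_le_1)
  have "a\<^sup>2 / y\<^sup>2 < a\<^sup>2 / x\<^sup>2"
    using assms by (intro divide_strict_left_mono power_strict_mono) auto
  moreover have "(1 - a\<^sup>2) / (y + d)\<^sup>2 \<le> (1 - a\<^sup>2) / (x + d)\<^sup>2"
    using assms \<open>a\<^sup>2 \<le> 1\<close> by (intro divide_left_mono power_mono) auto
  ultimately show ?thesis by (simp add: two_pole_def)
qed

lemma ex1_quartic_root:
  assumes "a \<noteq> 0" "\<bar>a\<bar> \<le> 1" "d \<ge> 0"
  shows "\<exists>!t. quartic_root a d t"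
proof -
  have a2: "a\<^sup>2 \<le> 1" using assms(2) by (simp add: abs_square_le_1)
  have lo: "1 \<le> two_pole a d \<bar>a\<bar>"
    using assms a2 by (simp add: two_pole_def)
  have "(1 - a\<^sup>2) / (1 + d)\<^sup>2 \<le> (1 - a\<^sup>2) / 1"
    using assms a2 by (intro divide_left_mono) (auto simp: one_le_power)
  then have hi: "two_pole a d 1 \<le> 1"
    by (simp add: two_pole_def)
  have "continuous_on {\<bar>a\<bar>..1} (two_pole a d)"
    unfolding two_pole_def[abs_def] using assms
    by (intro continuous_intros) (auto simp: add_nonneg_eq_0_iff)
  then obtain t where t: "\<bar>a\<bar> \<le> t" "t \<le> 1" "two_pole a d t = 1"
    using IVT2'[of "two_pole a d" 1 1 "\<bar>a\<bar>"] lo hi assms(2) by auto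
  have not_less: "\<not> x < y" if "\<bar>a\<bar> \<le> x" "two_pole a d x = 1" "two_pole a d y = 1" for x y
  proof
    assume "x < y"
    moreover have "0 < x" using that(1) assms(1) by linarith
    ultimately show False
      using two_pole_strict_antimono[OF assms, of x y] that by simp
  qed
  have uniq: "u = t" if "\<bar>a\<bar> \<le> u" "two_pole a d u = 1" for u
    using not_less[of u t] not_less[of t u] t that by linarith
  show ?thesis
  proof (rule ex1I)
    show "quartic_root a d t"
      using t assms by (simp add: quartic_root_iff_two_pole)
    show "u = t" if "quartic_root a d u" for u
      by (rule uniq) (use that assms in \<open>simp_all add: quartic_root_iff_two_pole\<close>)
  qed
qed

section \<open>Critical points of the secular function\<close>

definition inv_sq_sum :: "nat \<Rightarrow> (nat \<Rightarrow> real) \<Rightarrow> (nat \<Rightarrow> real) \<Rightarrow> real \<Rightarrow> real" where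
  "inv_sq_sum K s c l = (\<Sum>k = 1..K. (c k)\<^sup>2 / (l - s k)\<^sup>2)"

lemma mem_crit_points_iff_inv_sq_sum:
  "l \<in> crit_points K s c \<longleftrightarrow> l \<notin> s ` {1..K} \<and> inv_sq_sum K s c l = 1"
  by (auto simp: mem_crit_points_iff inv_sq_sum_def)

text \<open>The sum on the right is \<open>\<Sum>\<^sub>k (x\<^sub>k - y\<^sub>k)\<^sup>2 = 2 - 2 \<Sum>\<^sub>k x\<^sub>k y\<^sub>k\<close> for the two unit vectors
  \<open>x\<^sub>k = c\<^sub>k / (l - s\<^sub>k)\<close> and \<open>y\<^sub>k = c\<^sub>k / (m - s\<^sub>k)\<close>; it turns the difference quotient of the secular
  function into a sum of squares.\<close>

lemma secular_diff_crit:
  assumes "l \<in> crit_points K s c" "m \<in> crit_points K s c"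
  shows "secular K s c m - secular K s c l
    = (m - l) * ((\<Sum>k = 1..K. (c k / (l - s k) - c k / (m - s k))\<^sup>2) / 2)"
proof -
  have pole: "l - s k \<noteq> 0" "m - s k \<noteq> 0" if "k \<in> {1..K}" for k
    using assms that by (auto simp: mem_crit_points_iff)
  let ?ip = "\<Sum>k = 1..K. (c k)\<^sup>2 / ((l - s k) * (m - s k))"
  have expand: "(a / x - a / y)\<^sup>2 = a\<^sup>2 / x\<^sup>2 + a\<^sup>2 / y\<^sup>2 - 2 * (a\<^sup>2 / (x * y))" for a x y :: real
    by (simp add: power2_diff power_divide) (simp add: power2_eq_square)
  have "(\<Sum>k = 1..K. (c k / (l - s k) - c k / (m - s k))\<^sup>2)
      = (\<Sum>k = 1..K. (c k)\<^sup>2 / (l - s k)\<^sup>2 + (c k)\<^sup>2 / (m - s k)\<^sup>2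
          - 2 * ((c k)\<^sup>2 / ((l - s k) * (m - s k))))"
    by (simp only: expand)
  also have "\<dots> = 2 - 2 * ?ip"
    using assms
    by (simp add: sum_subtractf sum.distrib sum_distrib_left
        mem_crit_points_iff_inv_sq_sum inv_sq_sum_def)
  finally have sq: "(\<Sum>k = 1..K. (c k / (l - s k) - c k / (m - s k))\<^sup>2) / 2 = 1 - ?ip"
    by simp
  have frac: "w / y - w / x = - ((y - x) * (w / (x * y)))" if "x \<noteq> 0" "y \<noteq> 0" for w x y :: real
    using that by (simp add: diff_frac_eq) (simp add: minus_divide_left algebra_simps)
  have "(\<Sum>k = 1..K. (c k)\<^sup>2 / (m - s k)) - (\<Sum>k = 1..K. (c k)\<^sup>2 / (l - s k))
      = (\<Sum>k = 1..K. (c k)\<^sup>2 / (m - s k) - (c k)\<^sup>2 / (l - s k))"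
    by (simp only: sum_subtractf)
  also have "\<dots> = (\<Sum>k = 1..K. - ((m - l) * ((c k)\<^sup>2 / ((l - s k) * (m - s k)))))"
    using frac[OF pole] by (intro sum.cong refl) (simp only: diff_diff_eq2 diff_add_cancel)
  also have "\<dots> = - ((m - l) * ?ip)"
    by (simp only: sum_negf sum_distrib_left)
  finally have "secular K s c m - secular K s c l = (m - l) * (1 - ?ip)"
    by (simp add: secular_def algebra_simps)
  then show ?thesis by (simp only: sq)
qed

lemma secular_strict_mono_crit:
  assumes "l \<in> crit_points K s c" "m \<in> crit_points K s c" "l < m"
    and "i \<in> {1..K}" "c i \<noteq> 0"
  shows "secular K s c l < secular K s c m"
proof -
  have "l - s i \<noteq> 0" "m - s i \<noteq> 0"
    using assms by (auto simp: mem_crit_points_iff)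
  then have "0 < (c i / (l - s i) - c i / (m - s i))\<^sup>2"
    using assms by (simp add: divide_simps)
  then have "0 < (\<Sum>k = 1..K. (c k / (l - s k) - c k / (m - s k))\<^sup>2)"
    using assms(4) by (intro sum_pos2[of _ i]) auto
  with assms(3) have "0 < secular K s c m - secular K s c l"
    unfolding secular_diff_crit[OF assms(1,2)] by simp
  then show ?thesis by simp
qed

lemma inv_sq_sum_strict_mono:
  assumes "x < y" "\<And>k. k \<in> {1..K} \<Longrightarrow> y < s k"
    and "i \<in> {1..K}" "c i \<noteq> 0"
  shows "inv_sq_sum K s c x < inv_sq_sum K s c y"
proof -
  have sq: "0 < (y - s k)\<^sup>2" "(y - s k)\<^sup>2 < (x - s k)\<^sup>2" if "k \<in> {1..K}" for k
  proof -
    have "y < s k" using assms(2) that by blast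
    then show "0 < (y - s k)\<^sup>2" by simp
    have "(s k - y)\<^sup>2 < (s k - x)\<^sup>2"
      using \<open>y < s k\<close> assms(1) by (intro power_strict_mono) auto
    then show "(y - s k)\<^sup>2 < (x - s k)\<^sup>2" by (simp add: power2_commute)
  qed
  show ?thesis
    unfolding inv_sq_sum_def
  proof (rule sum_strict_mono_ex1)
    show "\<forall>k\<in>{1..K}. (c k)\<^sup>2 / (x - s k)\<^sup>2 \<le> (c k)\<^sup>2 / (y - s k)\<^sup>2"
      using sq by (meson divide_left_mono less_imp_le less_trans mult_pos_pos zero_le_power2)
    have "(c i)\<^sup>2 / (x - s i)\<^sup>2 < (c i)\<^sup>2 / (y - s i)\<^sup>2"
      using sq[OF assms(3)] assms(4)
      by (intro divide_strict_left_mono mult_pos_pos) auto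
    then show "\<exists>k\<in>{1..K}. (c k)\<^sup>2 / (x - s k)\<^sup>2 < (c k)\<^sup>2 / (y - s k)\<^sup>2"
      using assms(3) by blast
  qed simp
qed

text \<open>A critical point to the left of all poles is the only one there, hence the smallest, so
  the secular function is strictly larger at every other critical point.\<close>

lemma global_minimiser_iff_left_crit:
  assumes crit: "l \<in> crit_points K s c"
    and left: "\<And>k. k \<in> {1..K} \<Longrightarrow> l < s k"
    and i: "i \<in> {1..K}" "c i \<noteq> 0"
  shows "global_minimiser K s c m \<longleftrightarrow> m = l"
proof -
  have less: "secular K s c l < secular K s c m" if m: "m \<in> crit_points K s c" "m \<noteq> l" for m
  proof -
    have "\<not> m < l"
      using inv_sq_sum_strict_mono[of m l K s i c] left i crit m(1)
      by (auto simp: mem_crit_points_iff_inv_sq_sum)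
    then show ?thesis
      using secular_strict_mono_crit[OF crit m(1) _ i] m(2) by auto
  qed
  show ?thesis
  proof
    assume "global_minimiser K s c m"
    then show "m = l"
      using less crit by (auto simp: global_minimiser_def is_arg_min_def)
  next
    assume "m = l"
    with less crit show "global_minimiser K s c m"
      by (auto simp: global_minimiser_def is_arg_min_def) (metis less_asym less_irrefl)
  qed
qed

section \<open>Comparison with two poles\<close>

text \<open>Merging all poles but the first into one at distance \<open>d\<close> keeps their total weight
  \<open>1 - c\<^sub>1\<^sup>2\<close>, so the comparison with \<open>inv_sq_sum\<close> can be made term by term.\<close>

lemma two_pole_eq_sum:
  fixes c :: "nat \<Rightarrow> real"
  assumes "K \<ge> 1" "(\<Sum>k = 1..K. (c k)\<^sup>2) = 1"
  shows "two_pole (c 1) d t = (c 1)\<^sup>2 / t\<^sup>2 + (\<Sum>k = 2..K. (c k)\<^sup>2 / (t + d)\<^sup>2)"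
proof -
  have "(\<Sum>k = 2..K. (c k)\<^sup>2) = 1 - (c 1)\<^sup>2"
    using assms sum.atLeast_Suc_atMost[of 1 K "\<lambda>k. (c k)\<^sup>2"] by (simp add: numeral_2_eq_2)
  then show ?thesis
    by (simp add: two_pole_def sum_divide_distrib[symmetric])
qed

lemma inv_sq_sum_eq_sum:
  assumes "K \<ge> 1" "s 1 = 1"
  shows "inv_sq_sum K s c (1 - t)
    = (c 1)\<^sup>2 / t\<^sup>2 + (\<Sum>k = 2..K. (c k)\<^sup>2 / (t + (s k - 1))\<^sup>2)"
proof -
  have "(1 - t - s k)\<^sup>2 = (t + (s k - 1))\<^sup>2" for k
    by algebra
  then show ?thesis
    using assms sum.atLeast_Suc_atMost[of 1 K "\<lambda>k. (c k)\<^sup>2 / (1 - t - s k)\<^sup>2"]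
    by (simp add: inv_sq_sum_def numeral_2_eq_2)
qed

lemma inv_sq_sum_le_two_pole:
  assumes "K \<ge> 1" "s 1 = 1" "(\<Sum>k = 1..K. (c k)\<^sup>2) = 1" "t > 0" "d \<ge> 0"
    and far: "\<And>k. k \<in> {2..K} \<Longrightarrow> d \<le> s k - 1"
  shows "inv_sq_sum K s c (1 - t) \<le> two_pole (c 1) d t"
    and "j \<in> {2..K} \<Longrightarrow> c j \<noteq> 0 \<Longrightarrow> d < s j - 1 \<Longrightarrow>
      inv_sq_sum K s c (1 - t) < two_pole (c 1) d t"
proof -
  have le: "(c k)\<^sup>2 / (t + (s k - 1))\<^sup>2 \<le> (c k)\<^sup>2 / (t + d)\<^sup>2" if "k \<in> {2..K}" for k
    using far[OF that] assms(4,5) by (intro divide_left_mono power_mono) auto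
  then show "inv_sq_sum K s c (1 - t) \<le> two_pole (c 1) d t"
    unfolding two_pole_eq_sum[OF assms(1,3)] inv_sq_sum_eq_sum[of K s, OF assms(1,2)]
    by (intro add_left_mono sum_mono)
  assume j: "j \<in> {2..K}" "c j \<noteq> 0" "d < s j - 1"
  then have "(c j)\<^sup>2 / (t + (s j - 1))\<^sup>2 < (c j)\<^sup>2 / (t + d)\<^sup>2"
    using assms(4,5) by (intro divide_strict_left_mono power_strict_mono mult_pos_pos) auto
  with le j(1) show "inv_sq_sum K s c (1 - t) < two_pole (c 1) d t"
    unfolding two_pole_eq_sum[OF assms(1,3)] inv_sq_sum_eq_sum[of K s, OF assms(1,2)]
    by (intro add_strict_left_mono sum_strict_mono_ex1) auto
qed

lemma two_pole_le_inv_sq_sum: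
  assumes "K \<ge> 1" "s 1 = 1" "(\<Sum>k = 1..K. (c k)\<^sup>2) = 1" "t > 0"
    and near: "\<And>k. k \<in> {2..K} \<Longrightarrow> 1 \<le> s k \<and> s k - 1 \<le> d"
  shows "two_pole (c 1) d t \<le> inv_sq_sum K s c (1 - t)"
    and "j \<in> {2..K} \<Longrightarrow> c j \<noteq> 0 \<Longrightarrow> s j - 1 < d \<Longrightarrow>
      two_pole (c 1) d t < inv_sq_sum K s c (1 - t)"
proof -
  have le: "(c k)\<^sup>2 / (t + d)\<^sup>2 \<le> (c k)\<^sup>2 / (t + (s k - 1))\<^sup>2" if "k \<in> {2..K}" for k
    using near[OF that] assms(4) by (intro divide_left_mono power_mono) auto
  then show "two_pole (c 1) d t \<le> inv_sq_sum K s c (1 - t)"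
    unfolding two_pole_eq_sum[OF assms(1,3)] inv_sq_sum_eq_sum[of K s, OF assms(1,2)]
    by (intro add_left_mono sum_mono)
  assume j: "j \<in> {2..K}" "c j \<noteq> 0" "s j - 1 < d"
  then have "(c j)\<^sup>2 / (t + d)\<^sup>2 < (c j)\<^sup>2 / (t + (s j - 1))\<^sup>2"
    using near[OF j(1)] assms(4)
    by (intro divide_strict_left_mono power_strict_mono mult_pos_pos) auto
  with le j(1) show "two_pole (c 1) d t < inv_sq_sum K s c (1 - t)"
    unfolding two_pole_eq_sum[OF assms(1,3)] inv_sq_sum_eq_sum[of K s, OF assms(1,2)]
    by (intro add_strict_left_mono sum_strict_mono_ex1) auto
qed

section \<open>Location of the global minimiser\<close>

theorem lemma4:
  fixes K :: nat and s c :: "nat \<Rightarrow> real" and d1 d2 :: real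
  assumes "K \<ge> 2"
    and "s 1 = 1"
    and "mono_on {1..K} s"
    and "\<forall>k\<in>{1..K}. c k \<noteq> 0"
    and "(\<Sum>k = 1..K. (c k)\<^sup>2) = 1"
    and "d1 = s 2 - s 1"
    and "d2 = s K - s 1"
  shows "(\<exists>!t. quartic_root (c 1) d1 t) \<and>
    (\<exists>!t. quartic_root (c 1) d2 t) \<and>
    (\<exists>!l. global_minimiser K s c l) \<and>
    (\<forall>t1 t2 l. quartic_root (c 1) d1 t1 \<and> quartic_root (c 1) d2 t2 \<and> global_minimiser K s c l \<longrightarrow>
       (if s 2 = s K then t1 = t2 \<and> l = 1 - t1 else l \<in> {1 - t1<..<1 - t2}))"
proof -
  have K1: "K \<ge> 1" using assms(1) by simp
  have mono: "s j \<le> s k" if "1 \<le> j" "j \<le> k" "k \<le> K" for j k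
    using mono_onD[OF assms(3), of j k] that by simp
  have d: "0 \<le> d1" "0 \<le> d2"
    using mono[of 1 2] mono[of 1 K] assms(1,6,7) by auto
  have c1: "c 1 \<noteq> 0" using assms(1,4) by simp
  have "(c 1)\<^sup>2 \<le> (\<Sum>k = 1..K. (c k)\<^sup>2)"
    using K1 by (intro member_le_sum) auto
  then have c1_le: "\<bar>c 1\<bar> \<le> 1"
    using assms(5) by (simp add: abs_square_le_1)
  have root1: "\<exists>!t. quartic_root (c 1) d1 t" and root2: "\<exists>!t. quartic_root (c 1) d2 t"
    using ex1_quartic_root[OF c1 c1_le] d by auto
  then obtain t1 t2 where t: "quartic_root (c 1) d1 t1" "quartic_root (c 1) d2 t2"
    by blast
  have pos: "0 < t1" "0 < t2"
    and h: "two_pole (c 1) d1 t1 = 1" "two_pole (c 1) d2 t2 = 1"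
    using t c1 d by (auto simp: quartic_root_iff_two_pole)
  let ?\<phi> = "inv_sq_sum K s c"
  have le1: "?\<phi> (1 - t1) \<le> 1"
    using inv_sq_sum_le_two_pole(1)[where s=s and c=c and K=K and t=t1 and d=d1,
        OF K1 assms(2,5) pos(1) d(1)]
      mono[of 2] assms(2,6) h(1) by auto
  \<comment> \<open>Merging at \<open>s\<^sub>2\<close> moves the pole \<open>s\<^sub>K\<close>, merging at \<open>s\<^sub>K\<close> moves \<open>s\<^sub>2\<close>; these terms give
    the two strict inequalities.\<close>
  have less1: "?\<phi> (1 - t1) < 1" if "s 2 < s K"
    using inv_sq_sum_le_two_pole(2)[where s=s and c=c and K=K and t=t1 and d=d1 and j=K,
        OF K1 assms(2,5) pos(1) d(1)]
      mono[of 2] assms(1,2,4,6) h(1) that by auto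
  have near: "1 \<le> s k \<and> s k - 1 \<le> d2" if "k \<in> {2..K}" for k
    using mono[of 1 k] mono[of k K] that assms(2,7) by auto
  have ge2: "1 \<le> ?\<phi> (1 - t2)"
    using two_pole_le_inv_sq_sum(1)[where s=s and c=c and K=K and t=t2 and d=d2,
        OF K1 assms(2,5) pos(2) near]
      h(2) by auto
  have greater2: "1 < ?\<phi> (1 - t2)" if "s 2 < s K"
    using two_pole_le_inv_sq_sum(2)[where s=s and c=c and K=K and t=t2 and d=d2 and j=2,
        OF K1 assms(2,5) pos(2) near]
      assms(1,2,4,7) h(2) that by auto
  have left: "l < s k" if "l < 1" "k \<in> {1..K}" for l k
    using mono[of 1 k] that assms(2) by auto
  have "t2 \<le> t1"
  proof (rule ccontr)
    assume "\<not> t2 \<le> t1"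
    then have "?\<phi> (1 - t2) < ?\<phi> (1 - t1)"
      using inv_sq_sum_strict_mono[of "1 - t2" "1 - t1" K s 1 c] left pos c1 K1 by auto
    with le1 ge2 show False by simp
  qed
  moreover have "continuous_on {1 - t1..1 - t2} ?\<phi>"
    unfolding inv_sq_sum_def[abs_def] using left pos(2)
    by (intro continuous_intros) (force simp: less_le)
  ultimately obtain l where l: "1 - t1 \<le> l" "l \<le> 1 - t2" "?\<phi> l = 1"
    using IVT'[of ?\<phi> "1 - t1" 1 "1 - t2"] le1 ge2 by auto
  have "l < 1" using l(2) pos(2) by simp
  have "l \<in> crit_points K s c"
    using l(3) left[OF \<open>l < 1\<close>] by (force simp: mem_crit_points_iff_inv_sq_sum)
  then have min: "global_minimiser K s c m \<longleftrightarrow> m = l" for m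
    using global_minimiser_iff_left_crit[of l K s c 1] left[OF \<open>l < 1\<close>] c1 K1 by simp
  have loc: "if s 2 = s K then t1 = t2 \<and> l = 1 - t1 else l \<in> {1 - t1<..<1 - t2}"
  proof (cases "s 2 = s K")
    case True
    with t root1 assms(6,7) have "t1 = t2" by auto
    with True l show ?thesis by simp
  next
    case False
    then have "s 2 < s K" using mono[of 2 K] assms(1) by simp
    with less1 greater2 l(3) have "l \<noteq> 1 - t1" "l \<noteq> 1 - t2" by auto
    with l False show ?thesis by simp
  qed
  show ?thesis
  proof (intro conjI allI impI root1 root2)
    show "\<exists>!l. global_minimiser K s c l"
      using min by simp
    fix t1' t2' l'
    assume "quartic_root (c 1) d1 t1' \<and> quartic_root (c 1) d2 t2' \<and> global_minimiser K s c l'"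
    then have eq: "t1' = t1" "t2' = t2" "l' = l"
      using t root1 root2 min by blast+
    show "if s 2 = s K then t1' = t2' \<and> l' = 1 - t1' else l' \<in> {1 - t1'<..<1 - t2'}"
      unfolding eq by (rule loc)
  qed
qed

end
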